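(* Let $I\subset\mathbb{R}$ be a closed interval and $f:I\to I$ a piecewise monotone map with $m$ monotonicity intervals $I_1,\dots,I_m$. Let $k\le m$ be the number of those monotonicity intervals $I'$ satisfying one of the following: (i) $f$ is increasing on $I'$ and the left endpoint $a$ of the closure $\overline{I'}$ satisfies $f(a)<a$; or (ii) $f$ is decreasing on $I'$ and $I'$ contains a point $x$ with $f(x)<x$. Then $f$ has a forbidden pattern of length at most $2k+3$.
   Context: A map $f:I\to I$ on a closed interval $I$ is piecewise monotone if there is a finite partition of $I$ into intervals $I_1,\dots,I_m$ (its monotonicity intervals) on each of which $f$ is continuous and strictly monotone. For pairwise distinct reals $y_1,\dots,y_n$, the reduction $\rho(y_1,\dots,y_n)\in S_n$ is the permutation with the same relative order. For $x\in I$, $n\ge1$, $\mathrm{Pat}(x,f,n)=\rho(x,f(x),\dots,f^{n-1}(x))$, defined when these $n$ values are pairwise distinct. A permutation $\pi\in S_n$ is an allowed pattern of $f$ if $\pi=\mathrm{Pat}(x,f,n)$ for some $x\in I$, and a forbidden pattern otherwise.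
   Formalization: In (i), when the left endpoint a is not in I', f(a) is read as the one-sided limit of f at a along I'; with the literal f(a) the claim fails, e.g. f(x)=2x on [0,1/2], 2x−1 on (1/2,1], where k=0 but all patterns of length 3 occur. *)

theory Defs
  imports "HOL-Analysis.Analysis" "HOL-Combinatorics.Permutations"
begin

text \<open>Partitions may contain degenerate (one-point) intervals, on which a map is vacuously
  both increasing and decreasing.\<close>

definition monotonicity_intervals :: "(real \<Rightarrow> real) \<Rightarrow> real set \<Rightarrow> real set set \<Rightarrow> bool" where
  "monotonicity_intervals f I P \<longleftrightarrow>
     finite P \<and> partition_on I P \<and>
     (\<forall>J\<in>P. is_interval J \<and> continuous_on J f \<and> (strict_mono_on J f \<or> strict_antimono_on J f))"

text \<open>The value at the left endpoint \<open>a\<close> of the closure of \<open>J\<close> is that of the continuous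
  extension of the branch of \<open>f\<close> on \<open>J\<close>. If \<open>a \<notin> J\<close>, the number \<open>f a\<close> itself
  belongs to the neighbouring branch and says nothing about \<open>J\<close>, because \<open>f\<close> may jump at \<open>a\<close>.\<close>

definition left_endpoint :: "real set \<Rightarrow> real" where
  "left_endpoint J = Inf (closure J)"

definition left_endpoint_value :: "(real \<Rightarrow> real) \<Rightarrow> real set \<Rightarrow> real" where
  "left_endpoint_value f J =
     (let a = left_endpoint J in if a \<in> J then f a else Lim (at a within J) f)"

definition descending_interval :: "(real \<Rightarrow> real) \<Rightarrow> real set \<Rightarrow> bool" where
  "descending_interval f J \<longleftrightarrow>
     (strict_mono_on J f \<and> left_endpoint_value f J < left_endpoint J) \<or>
     (strict_antimono_on J f \<and> (\<exists>x\<in>J. f x < x))"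

text \<open>Elements of $S_n$ are functions permuting \<open>{1..n}\<close> (and fixing everything else).\<close>

definition same_relative_order :: "nat \<Rightarrow> (nat \<Rightarrow> real) \<Rightarrow> (nat \<Rightarrow> nat) \<Rightarrow> bool" where
  "same_relative_order n y \<pi> \<longleftrightarrow>
     (\<forall>i\<in>{1..n}. \<forall>j\<in>{1..n}. \<pi> i < \<pi> j \<longleftrightarrow> y i < y j)"

definition reduction :: "nat \<Rightarrow> (nat \<Rightarrow> real) \<Rightarrow> nat \<Rightarrow> nat" where
  "reduction n y = (THE \<pi>. \<pi> permutes {1..n} \<and> same_relative_order n y \<pi>)"

definition orbit :: "real \<Rightarrow> (real \<Rightarrow> real) \<Rightarrow> nat \<Rightarrow> real" where
  "orbit x f i = (f ^^ (i - 1)) x"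

definition pattern_defined :: "real \<Rightarrow> (real \<Rightarrow> real) \<Rightarrow> nat \<Rightarrow> bool" where
  "pattern_defined x f n \<longleftrightarrow> inj_on (orbit x f) {1..n}"

definition Pat :: "real \<Rightarrow> (real \<Rightarrow> real) \<Rightarrow> nat \<Rightarrow> nat \<Rightarrow> nat" where
  "Pat x f n = reduction n (orbit x f)"

definition allowed_pattern :: "(real \<Rightarrow> real) \<Rightarrow> real set \<Rightarrow> nat \<Rightarrow> (nat \<Rightarrow> nat) \<Rightarrow> bool" where
  "allowed_pattern f I n \<pi> \<longleftrightarrow>
     \<pi> permutes {1..n} \<and> (\<exists>x\<in>I. pattern_defined x f n \<and> \<pi> = Pat x f n)"

definition forbidden_pattern :: "(real \<Rightarrow> real) \<Rightarrow> real set \<Rightarrow> nat \<Rightarrow> (nat \<Rightarrow> nat) \<Rightarrow> bool" where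
  "forbidden_pattern f I n \<pi> \<longleftrightarrow> \<pi> permutes {1..n} \<and> \<not> allowed_pattern f I n \<pi>"

lemma ex1_reduction:
  assumes "inj_on y {1..n}"
  shows "\<exists>!\<pi>. \<pi> permutes {1..n} \<and> same_relative_order n y \<pi>"
proof -
  define r where "r i = (if i \<in> {1..n} then card {j\<in>{1..n}. y j \<le> y i} else i)" for i
  have mono: "r i < r j" if "i \<in> {1..n}" "j \<in> {1..n}" "y i < y j" for i j
  proof -
    have "{l\<in>{1..n}. y l \<le> y i} \<subset> {l\<in>{1..n}. y l \<le> y j}"
    proof
      show "{l\<in>{1..n}. y l \<le> y i} \<subseteq> {l\<in>{1..n}. y l \<le> y j}"
        using that by auto
      have "j \<in> {l\<in>{1..n}. y l \<le> y j} - {l\<in>{1..n}. y l \<le> y i}"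
        using that by auto
      then show "{l\<in>{1..n}. y l \<le> y i} \<noteq> {l\<in>{1..n}. y l \<le> y j}"
        by blast
    qed
    then show ?thesis
      using that by (simp add: r_def psubset_card_mono)
  qed
  have ord: "same_relative_order n y r"
    unfolding same_relative_order_def
  proof (intro ballI iffI)
    fix i j assume ij: "i \<in> {1..n}" "j \<in> {1..n}" "r i < r j"
    then have "y i \<noteq> y j"
      using assms by (auto dest: inj_onD)
    then show "y i < y j"
      using mono[OF ij(2,1)] ij(3) by linarith
  qed (use mono in blast)
  have inj: "inj_on r {1..n}"
  proof (rule inj_onI)
    fix i j assume ij: "i \<in> {1..n}" "j \<in> {1..n}" "r i = r j"
    then have "y i = y j"
      using mono[OF ij(1,2)] mono[OF ij(2,1)] by linarith
    then show "i = j"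
      using assms ij by (auto dest: inj_onD)
  qed
  have "r i \<in> {1..n}" if "i \<in> {1..n}" for i
  proof -
    have "card {j\<in>{1..n}. y j \<le> y i} \<le> card {1..n}"
      by (rule card_mono) auto
    moreover have "card {j\<in>{1..n}. y j \<le> y i} > 0"
      using that by (subst card_gt_0_iff) auto
    ultimately show ?thesis
      using that by (simp add: r_def)
  qed
  then have "r ` {1..n} = {1..n}"
    by (intro endo_inj_surj inj) auto
  then have "r permutes {1..n}"
    using inj by (intro bij_imp_permutes) (auto simp: bij_betw_def r_def)
  moreover have "\<pi> = r" if "\<pi> permutes {1..n}" "same_relative_order n y \<pi>" for \<pi>
  proof
    fix i
    show "\<pi> i = r i"
    proof (cases "i \<in> {1..n}")
      case True
      have "{j\<in>{1..n}. y j \<le> y i} = {j\<in>{1..n}. \<pi> j \<le> \<pi> i}"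
        using that(2) True unfolding same_relative_order_def by (auto simp: not_less[symmetric])
      moreover have "\<pi> ` {j\<in>{1..n}. \<pi> j \<le> \<pi> i} = {1..\<pi> i}"
      proof -
        have im: "\<pi> ` {1..n} = {1..n}" using that(1) by (rule permutes_image)
        then have "\<pi> i \<in> {1..n}" using True by blast
        then have "l \<in> \<pi> ` {1..n}" if "l \<in> {1..\<pi> i}" for l
          using that im by auto
        then show ?thesis using im by fastforce
      qed
      moreover have "inj_on \<pi> {j\<in>{1..n}. \<pi> j \<le> \<pi> i}"
        using permutes_inj[OF that(1)] by (rule inj_on_subset) simp
      ultimately have "card {j\<in>{1..n}. y j \<le> y i} = \<pi> i"
        by (metis card_image card_atLeastAtMost diff_Suc_1)
      then show ?thesis using True by (simp add: r_def)
    next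
      case False
      then show ?thesis using that(1) by (auto simp: r_def permutes_not_in)
    qed
  qed
  ultimately show ?thesis using ord by blast
qed

end

theory Submission
  imports Defs
begin

text \<open>If \<open>f x < x\<close> and \<open>f x < f (f x)\<close>, then \<open>x\<close> lies in a descending interval: on an increasing
  branch that does not descend at its left endpoint, a descent is followed by descents forever.
  The forbidden pattern is \<open>2 1 4 3 \<dots> (2k+2) (2k+1) (2k+3)\<close>. An orbit realizing it would have
  such an \<open>x\<close> at each of the \<open>k + 1\<close> odd positions \<open>1, 3, \<dots>, 2k+1\<close>, so two of them, \<open>x < y\<close>, would
  share an interval \<open>J\<close>. In the pattern \<open>f x < x < f y < y\<close> and \<open>f y < f (f y)\<close>, so \<open>f y\<close> is in \<open>J\<close>
  too, which is impossible both for increasing and for decreasing \<open>f\<close>.\<close>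

text \<open>Evaluates the \<open>Lim\<close> in \<open>left_endpoint_value\<close> when the left
  endpoint is missing from the branch. A value \<open>f z\<close> close to the infimum bounds
  \<open>f\<close> on all of \<open>J\<close> left of \<open>z\<close>, and \<open>{..<z}\<close> is
  a neighbourhood of \<open>a\<close>.\<close>

lemma strict_mono_on_tendsto_Inf_image:
  fixes f :: "real \<Rightarrow> real"
  assumes mono: "strict_mono_on J f" and "J \<noteq> {}" and bdd: "bdd_below (f ` J)"
    and a: "\<And>y. y \<in> J \<Longrightarrow> a < y"
  shows "(f \<longlongrightarrow> Inf (f ` J)) (at a within J)"
proof (rule order_tendstoI)
  fix e assume "e < Inf (f ` J)"
  then have "e < f y" if "y \<in> J" for y
    using that bdd by (meson cInf_lower imageI less_le_trans)
  then show "\<forall>\<^sub>F y in at a within J. e < f y"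
    by (simp add: eventually_at_filter)
next
  fix e assume "Inf (f ` J) < e"
  then obtain z where z: "z \<in> J" "f z < e"
    using bdd \<open>J \<noteq> {}\<close> by (auto simp: cInf_less_iff)
  have "\<forall>\<^sub>F y in at a within J. y \<in> {..<z} \<inter> J"
    using a[OF z(1)] by (auto simp: eventually_at_topological intro!: exI[of _ "{..<z}"])
  then show "\<forall>\<^sub>F y in at a within J. f y < e"
  proof (rule eventually_mono)
    fix y assume "y \<in> {..<z} \<inter> J"
    then have "f y < f z"
      using mono z(1) by (auto dest: strict_mono_onD)
    then show "f y < e"
      using z(2) by simp
  qed
qed

lemma Inf_closure_real:
  fixes S :: "real set"
  assumes "S \<noteq> {}" "bdd_below S"
  shows "Inf (closure S) = Inf S"
proof (rule cInf_eq_minimum)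
  show "Inf S \<in> closure S"
    using assms by (rule closure_contains_Inf)
  have "closure S \<subseteq> {Inf S..}"
    using assms(2) by (intro closure_minimal) (auto intro: cInf_lower)
  then show "Inf S \<le> x" if "x \<in> closure S" for x
    using that by auto
qed

text \<open>On an increasing branch the ascent after the descent forces \<open>f x\<close> out of
  \<open>J\<close>, hence below all of \<open>J\<close>. Values of \<open>f\<close> to the left of
  \<open>x\<close> are smaller still, so the branch starts below its own left endpoint.\<close>

lemma descent_then_ascent_imp_descending_interval:
  assumes J: "is_interval J" "strict_mono_on J f \<or> strict_antimono_on J f"
    and bdd: "bdd_below J" "bdd_below (f ` J)"
    and x: "x \<in> J" "f x < x" "f x < f (f x)"
  shows "descending_interval f J"
proof (cases "strict_antimono_on J f")
  case True
  then show ?thesis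
    using x by (auto simp: descending_interval_def)
next
  case False
  then have mono: "strict_mono_on J f"
    using J(2) by blast
  have notin: "f x \<notin> J"
    using strict_mono_onD[OF mono _ x(1) x(2)] x(3) by auto
  \<comment> \<open>Otherwise \<open>y <= f x < x\<close> would put \<open>f x\<close> into the
    interval \<open>J\<close>.\<close>
  have low: "f x < y" if "y \<in> J" for y
    using J(1) that x(1,2) notin unfolding is_interval_1 by (meson linorder_not_less less_imp_le)
  define a where "a = left_endpoint J"
  have "J \<noteq> {}"
    using x(1) by blast
  then have a: "a = Inf J"
    using bdd(1) by (simp add: a_def left_endpoint_def Inf_closure_real)
  have le: "a \<le> y" if "y \<in> J" for y
    using that bdd(1) a by (simp add: cInf_lower)
  have fxa: "f x \<le> a"
    using low \<open>J \<noteq> {}\<close> a by (metis cInf_greatest less_imp_le)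
  have "left_endpoint_value f J < a"
  proof (cases "a \<in> J")
    case True
    then have "f a \<le> f x"
      using le[OF x(1)] mono x(1) by (metis less_eq_real_def strict_mono_onD)
    then show ?thesis
      using True low[OF True] by (simp add: left_endpoint_value_def Let_def flip: a_def)
  next
    case False
    then have less: "a < y" if "y \<in> J" for y
      using le[OF that] that by (metis order_le_less)
    have "a \<in> closure J"
      using closure_contains_Inf[OF \<open>J \<noteq> {}\<close> bdd(1)] a by simp
    then have "at a within J \<noteq> bot"
      using False by (simp add: at_within_eq_bot_iff)
    then have Lim: "Lim (at a within J) f = Inf (f ` J)"
      using strict_mono_on_tendsto_Inf_image[OF mono \<open>J \<noteq> {}\<close> bdd(2) less]
      by (simp add: tendsto_Lim)
    \<comment> \<open>Here \<open>f x = a\<close> is possible, since \<open>low\<close> says nothing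
      about a point outside \<open>J\<close>. The strict inequality comes from a point of
      \<open>J\<close> to the left of \<open>x\<close>.\<close>
    obtain y where y: "y \<in> J" "y < x"
      using less[OF x(1)] \<open>J \<noteq> {}\<close> bdd(1) a by (auto simp: cInf_less_iff)
    have "Inf (f ` J) \<le> f y"
      using bdd(2) y(1) by (simp add: cInf_lower)
    also have "\<dots> < f x"
      using mono y x(1) by (auto dest: strict_mono_onD)
    finally show ?thesis
      using False fxa Lim by (simp add: left_endpoint_value_def Let_def flip: a_def)
  qed
  then show ?thesis
    using mono by (simp add: descending_interval_def a_def)
qed

text \<open>As \<open>f y\<close> lies between \<open>x\<close> and \<open>y\<close>, monotonicity
  applies to it: an increasing \<open>f\<close> turns \<open>f y < y\<close> into a second descent,
  and a decreasing \<open>f\<close> turns \<open>x < f y\<close> into \<open>f (f y) < f x\<close>,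
  which is below \<open>f y\<close>.\<close>

lemma interlaced_descents_not_in_same_interval:
  fixes f :: "real \<Rightarrow> real"
  assumes "is_interval J" "strict_mono_on J f \<or> strict_antimono_on J f"
    and "x \<in> J" "y \<in> J" "f x < x" "x < f y" "f y < y" "f y < f (f y)"
  shows False
proof -
  have fy: "f y \<in> J"
    using assms unfolding is_interval_1 by (meson less_imp_le)
  show False
    using assms(2)
  proof
    assume "strict_mono_on J f"
    then have "f (f y) < f y"
      using fy assms by (auto dest: strict_mono_onD)
    then show False
      using assms by simp
  next
    assume "strict_antimono_on J f"
    then have "f (f y) < f x"
      using fy assms by (auto simp: monotone_on_def)
    then show False
      using assms by simp
  qed
qed

lemma Pat_less_iff:
  assumes "pattern_defined x f n" "i \<in> {1..n}" "j \<in> {1..n}"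
  shows "Pat x f n i < Pat x f n j \<longleftrightarrow> orbit x f i < orbit x f j"
proof -
  have "same_relative_order n (orbit x f) (Pat x f n)"
    using theI'[OF ex1_reduction[of "orbit x f" n]] assms(1)
    by (simp add: Pat_def reduction_def pattern_defined_def)
  then show ?thesis
    using assms by (simp add: same_relative_order_def)
qed

text \<open>The fixed top entry \<open>2 * k + 3\<close> supplies the ascent after the last swapped
  pair; after any earlier pair the next pair does so.\<close>

definition swap_pairs :: "nat \<Rightarrow> nat \<Rightarrow> nat" where
  "swap_pairs k i = (if i \<in> {1..2 * k + 2} then if odd i then i + 1 else i - 1 else i)"

lemma swap_pairs_odd: "j \<le> k \<Longrightarrow> swap_pairs k (2 * j + 1) = 2 * j + 2"
  by (simp add: swap_pairs_def)

lemma swap_pairs_even: "j \<le> k \<Longrightarrow> swap_pairs k (2 * j + 2) = 2 * j + 1"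
  by (simp add: swap_pairs_def)

lemma swap_pairs_ascent:
  assumes "j \<le> k"
  shows "swap_pairs k (2 * j + 2) < swap_pairs k (2 * j + 3)"
  using assms by (auto simp: swap_pairs_def)

lemma swap_pairs_permutes: "swap_pairs k permutes {1..2 * k + 3}"
proof -
  have inv: "swap_pairs k (swap_pairs k i) = i" for i
    unfolding swap_pairs_def by (auto elim!: oddE evenE)
  have "swap_pairs k i = i" if "i \<notin> {1..2 * k + 3}" for i
    using that by (auto simp: swap_pairs_def)
  then show ?thesis
    unfolding permutes_def using inv by metis
qed

lemma swap_pairs_forbidden:
  assumes I: "f ` {c..d} \<subseteq> {c..d}" and P: "monotonicity_intervals f {c..d} P"
    and k: "card {J \<in> P. descending_interval f J} \<le> k"
  shows "\<not> allowed_pattern f {c..d} (2 * k + 3) (swap_pairs k)"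
proof
  assume "allowed_pattern f {c..d} (2 * k + 3) (swap_pairs k)"
  then obtain x where x: "x \<in> {c..d}" "pattern_defined x f (2 * k + 3)"
    and pat: "swap_pairs k = Pat x f (2 * k + 3)"
    by (auto simp: allowed_pattern_def)
  have J: "is_interval J" "strict_mono_on J f \<or> strict_antimono_on J f" "J \<subseteq> {c..d}"
    if "J \<in> P" for J
    using that P by (auto simp: monotonicity_intervals_def partition_on_def)
  \<comment> \<open>\<open>orbit\<close> counts from 1, so these are the entries at the odd
    positions \<open>2 * j + 1\<close>, where the swapped pairs begin.\<close>
  define p where "p j = (f ^^ (2 * j)) x" for j
  have orbit: "orbit x f (2 * j + 1) = p j" "orbit x f (2 * j + 2) = f (p j)"
    "orbit x f (2 * j + 3) = f (f (p j))" for j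
    by (simp_all add: orbit_def p_def)
  have order: "orbit x f i < orbit x f j"
    if "swap_pairs k i < swap_pairs k j" "i \<in> {1..2 * k + 3}" "j \<in> {1..2 * k + 3}" for i j
    using Pat_less_iff[OF x(2) that(2,3)] that(1) by (simp add: pat)
  have desc: "f (p j) < p j" if "j \<le> k" for j
    using order[of "2 * j + 2" "2 * j + 1"] that
    unfolding orbit by (simp only: swap_pairs_odd swap_pairs_even) simp
  have asc: "f (p j) < f (f (p j))" if "j \<le> k" for j
    using order[of "2 * j + 2" "2 * j + 3"] swap_pairs_ascent[OF that] that
    unfolding orbit by simp
  \<comment> \<open>The pattern has the entries \<open>2 * i + 2\<close> and
    \<open>2 * j + 1\<close> at these two positions.\<close>
  have sep: "p i < f (p j)" if "i < j" "j \<le> k" for i j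
    using order[of "2 * i + 1" "2 * j + 2"] swap_pairs_odd[of i k] swap_pairs_even[of j k] that
    unfolding orbit by simp
  have "(f ^^ n) x \<in> {c..d}" for n
    using x(1) I by (induction n) (simp_all add: image_subset_iff)
  then have "\<forall>j. \<exists>J\<in>P. p j \<in> J"
    using P by (auto simp: p_def monotonicity_intervals_def partition_on_def)
  then obtain g where g: "\<And>j. g j \<in> P" "\<And>j. p j \<in> g j"
    by metis
  have "descending_interval f (g j)" if "j \<le> k" for j
  proof (rule descent_then_ascent_imp_descending_interval)
    show "bdd_below (g j)"
      using J(3)[OF g(1)] by (meson bdd_below_Icc bdd_below_mono)
    show "bdd_below (f ` g j)"
      using J(3)[OF g(1)] I by (meson bdd_below_Icc bdd_below_mono image_mono)
  qed (use J g desc asc that in auto)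
  then have "g ` {..k} \<subseteq> {J \<in> P. descending_interval f J}"
    using g by auto
  moreover have "finite {J \<in> P. descending_interval f J}"
    using P by (simp add: monotonicity_intervals_def)
  moreover have "inj_on g {..k}"
  proof (rule linorder_inj_onI)
    fix i j assume ij: "i < j" "i \<in> {..k}" "j \<in> {..k}"
    then show "g i \<noteq> g j"
      using interlaced_descents_not_in_same_interval[of "g j" f "p i" "p j"]
        J(1,2)[OF g(1)[of j]] g(2)[of i] g(2)[of j] desc[of i] desc[of j] asc[of j] sep[of i j]
      by auto
  qed auto
  \<comment> \<open>Pigeonhole: \<open>{..k}\<close> has \<open>k + 1\<close> elements, one more
    than the descending intervals allow.\<close>
  ultimately have "card {..k} \<le> card {J \<in> P. descending_interval f J}"
    by (metis card_inj_on_le)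
  then show False
    using k by simp
qed

theorem theorem4p1:
  fixes f :: "real \<Rightarrow> real" and c d :: real and P :: "real set set" and m k :: nat
  assumes "c \<le> d"
    and "f ` {c..d} \<subseteq> {c..d}"
    and "monotonicity_intervals f {c..d} P"
    and "m = card P"
    and "k = card {J \<in> P. descending_interval f J}"
  shows "k \<le> m \<and> (\<exists>n \<pi>. 1 \<le> n \<and> n \<le> 2 * k + 3 \<and> forbidden_pattern f {c..d} n \<pi>)"
proof
  show "k \<le> m"
    using assms(3-5) by (auto simp: monotonicity_intervals_def intro: card_mono)
  have "forbidden_pattern f {c..d} (2 * k + 3) (swap_pairs k)"
    using swap_pairs_forbidden[OF assms(2,3)] swap_pairs_permutes assms(5)
    by (simp add: forbidden_pattern_def)
  then show "\<exists>n \<pi>. 1 \<le> n \<and> n \<le> 2 * k + 3 \<and> forbidden_pattern f {c..d} n \<pi>"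
    by (intro exI[of _ "2 * k + 3"] exI[of _ "swap_pairs k"]) simp
qed

end
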